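(* For any centered Gaussian random vector $(X_1,X_2,X_3)$ (each $X_i$ real-valued with positive variance), $$E[X_1^{8}X_2^{6}X_3^{4}]\ge E[X_1^{8}]\,E[X_2^{6}]\,E[X_3^{4}],$$ and equality holds if and only if $X_1,X_2,X_3$ are independent.
   Context: All Gaussian random variables are assumed real-valued and non-degenerate (positive variance). *)

theory Defs
  imports "HOL-Probability.Probability"
begin

definition centered_gaussian_rv :: "'a measure \<Rightarrow> ('a \<Rightarrow> real) \<Rightarrow> bool" where
  "centered_gaussian_rv M Y \<longleftrightarrow>
     Y \<in> borel_measurable M \<and>
     ((AE \<omega> in M. Y \<omega> = 0) \<or>
      (\<exists>\<sigma>>0. distributed M lborel Y (\<lambda>x. ennreal (normal_density 0 \<sigma> x))))"

definition centered_gaussian_vector ::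
    "'a measure \<Rightarrow> ('i \<Rightarrow> 'a \<Rightarrow> real) \<Rightarrow> 'i set \<Rightarrow> bool" where
  "centered_gaussian_vector M X I \<longleftrightarrow>
     (\<forall>c :: 'i \<Rightarrow> real. centered_gaussian_rv M (\<lambda>\<omega>. \<Sum>i\<in>I. c i * X i \<omega>))"

end

theory Submission
  imports Defs "HOL-Computational_Algebra.Polynomial"
begin

text \<open>
  After normalising the variances to 1, expanding \<open>E[(X\<^sub>1 + s X\<^sub>2 + t X\<^sub>3)^18] = 17!! Var^9\<close> and comparing
  coefficients of \<open>t^4\<close> and then \<open>s^6\<close> expresses the mixed moment as 4725 times a polynomial in the
  correlations \<open>a\<close>, \<open>b\<close>, \<open>c\<close>. Its monomials of odd degree are all multiples of \<open>abc\<close>, so the inequality is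
  immediate for \<open>abc \<ge> 0\<close>; for \<open>abc < 0\<close> there is a weighted sum-of-squares certificate that uses the
  nonnegative determinant of the correlation matrix. Both cases leave a surplus proportional to
  \<open>a^2 + b^2 + c^2\<close>, so equality forces the variables to be uncorrelated. Uncorrelated jointly Gaussian
  variables have a factorising joint characteristic function, and independence is deduced from the
  one-dimensional uniqueness theorem of Levy, exchanging one exponential at a time for an indicator.
\<close>

section \<open>The moment polynomial\<close>

text \<open>The coefficients count pairings of the 18 factors: \<open>moment_poly\<close> is the Isserlis sum for
  unit variances, divided by \<open>4725 = 7!! 5!! 3!!\<close>.\<close>

definition moment_poly :: "real \<Rightarrow> real \<Rightarrow> real \<Rightarrow> real" where
  "moment_poly a b c =
    1 + 24 * a^2 + 16 * b^2 + 12 * c^2 + 48 * a^4 + 288 * a^2 * b^2 + 192 * a^2 * c^2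
    + 16 * b^4 + 96 * b^2 * c^2 + 8 * c^4 + 64/5 * a^6 + 384 * a^4 * b^2 + 192 * a^4 * c^2
    + 192 * a^2 * b^4 + 1152 * a^2 * b^2 * c^2 + 64 * a^2 * c^4 + 256/5 * a^6 * b^2
    + 128 * a^4 * b^4 + 768 * a^4 * b^2 * c^2
    + a * b * c * (192 + 768 * a^2 + 384 * b^2 + 256 * c^2 + 1536/5 * a^4
      + 1024 * a^2 * b^2 + 512 * a^2 * c^2 + 1024/5 * a^4 * b^2)"

text \<open>The surplus \<open>(a^2 + b^2 + c^2) / 3\<close> is kept in the lower bound because it
  settles the equality case: \<open>moment_poly a b c = 1\<close> then forces
  \<open>a = b = c = 0\<close>.\<close>

lemma moment_poly_bound:
  fixes a b c :: real
  assumes det: "0 \<le> 1 - a^2 - b^2 - c^2 + 2 * a * b * c"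
  shows "1 + (a^2 + b^2 + c^2) / 3 \<le> moment_poly a b c"
proof (cases "0 \<le> a * b * c")
  case True
  \<comment> \<open>\<open>R\<close> collects the monomials even in each variable, after the surplus
    is removed (24 - 1/3 = 71/3 and so on); \<open>T\<close> is the cofactor of
    \<open>a * b * c\<close>. All their coefficients are positive.\<close>
  define R where "R =
    71/3 * a^2 + 47/3 * b^2 + 35/3 * c^2 + 48 * a^4 + 288 * a^2 * b^2 + 192 * a^2 * c^2
    + 16 * b^4 + 96 * b^2 * c^2 + 8 * c^4 + 64/5 * a^6 + 384 * a^4 * b^2 + 192 * a^4 * c^2
    + 192 * a^2 * b^4 + 1152 * a^2 * b^2 * c^2 + 64 * a^2 * c^4 + 256/5 * a^6 * b^2
    + 128 * a^4 * b^4 + 768 * a^4 * b^2 * c^2"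
  define T where "T =
    192 + 768 * a^2 + 384 * b^2 + 256 * c^2 + 1536/5 * a^4 + 1024 * a^2 * b^2
    + 512 * a^2 * c^2 + 1024/5 * a^4 * b^2"
  have "0 \<le> R"
    unfolding R_def by simp
  moreover have "0 \<le> a * b * c * T"
    by (rule mult_nonneg_nonneg[OF True]) (simp add: T_def)
  moreover have "moment_poly a b c = 1 + (a^2 + b^2 + c^2) / 3 + R + a * b * c * T"
    unfolding moment_poly_def R_def T_def by (simp add: field_simps)
  ultimately show ?thesis
    by linarith
next
  case False
  define d where "d = 1 - a^2 - b^2 - c^2 + 2 * a * b * c"
  \<comment> \<open>The certificate was found by semidefinite programming and rounded to rational numbers.\<close>
  define S where "S =
    87/8 * (4 * a * b^2 + b * c)^2 + 13 * (4 * a * b * c + c^2)^2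
    + 49/4 * (2 * a * b * c + b^2)^2 + 57 * (2 * a^2 * b + a * c)^2
    + 223/18 * (3 * b * c + a + 3 * a * c^2 + 3 * a * b^2 + 3 * a^2 * b * c)^2
    + 457/4 * (2 * a^2 * b * c + a * b^2)^2 + 73/8 * (4 * a^2 * b + a * c)^2
    + 37/2 * (4 * a^2 * b * c + a * c^2)^2 + 50 * (a^2 + 2 * a * b * c)^2
    + 15/4 * (2 * a^2 * c + a * b)^2 + 6 * (2 * a * b * c + c^2)^2
    + 121/2 * (a^2 * b^2 + a * b * c)^2
    + 170/9 * (b^2 + 3 * a * b * c + a^2 - a^2 * b^2)^2
    + 23/18 * (2 * a - a * c^2 - a * b^2 + 2 * a^2 * b * c - 3 * a^3)^2
    + 485/18 * (a * b + 3 * a^2 * c + 2 * a^3 * b)^2 + 15/2 * b^2 * d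
    + 49/6 * (b + 3 * a * c)^2 * d + 23/2 * (c + 3 * a * b)^2 * d + 68 * (a * b)^2 * d
    + 6 * a^2 * d + 205/2 * (a^2 * b)^2 * d"
  \<comment> \<open>\<open>R\<close> and \<open>T\<close> are what the certificate \<open>S\<close>
    leaves over: even monomials with positive coefficients, those of \<open>T\<close> multiplied by
    the positive number \<open>- (a * b * c)\<close>.\<close>
  define R where "R =
    1/6 * a^2 + 1/6 * c^2 + 4/9 * a^4 + 17/36 * a^2 * b^2 + 47/72 * a^2 * c^2
    + 19/36 * b^4 + 19/24 * b^2 * c^2 + 1/2 * c^4 + 13/10 * a^6 + 4/3 * a^4 * b^2
    + 1/3 * a^4 * c^2 + 1/4 * a^2 * b^4 + 17/18 * a^2 * b^2 * c^2 + 56/9 * a^2 * c^4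
    + 4133/90 * a^6 * b^2 + 1360/9 * a^4 * b^4 + 8/9 * a^4 * b^2 * c^2"
  define T where "T =
    1/3 + 14/9 * a^2 + 5/3 * b^2 + 4/5 * a^4 + 14/9 * a^2 * b^2 + 8/9 * a^2 * c^2
    + 1/5 * a^4 * b^2"
  have "0 \<le> d"
    using det by (simp add: d_def)
  then have "0 \<le> S"
    unfolding S_def by (intro add_nonneg_nonneg mult_nonneg_nonneg) simp_all
  moreover have "0 \<le> R"
    unfolding R_def by simp
  moreover have "0 \<le> - (a * b * c) * T"
    using False by (intro mult_nonneg_nonneg) (simp_all add: T_def)
  moreover have "moment_poly a b c = 1 + (a^2 + b^2 + c^2) / 3 + S + R + - (a * b * c) * T"
    unfolding moment_poly_def S_def R_def T_def d_def by (simp add: field_simps eval_nat_numeral)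
  ultimately show ?thesis
    by linarith
qed

section \<open>Moments of Gaussian variables\<close>

context prob_space
begin

lemma gaussian_integrable_power:
  assumes "centered_gaussian_rv M Y"
  shows "integrable M (\<lambda>\<omega>. Y \<omega> ^ n)"
  using assms unfolding centered_gaussian_rv_def
proof (elim conjE disjE exE)
  assume "Y \<in> borel_measurable M" "AE \<omega> in M. Y \<omega> = 0"
  \<comment> \<open>The bound is \<open>0 ^ n\<close> and not 0, since the power is 1 when
    \<open>n = 0\<close>.\<close>
  then show ?thesis
    by (intro integrable_const_bound[where B = "0 ^ n"]) auto
next
  fix s :: real assume "0 < s" "distributed M lborel Y (\<lambda>x. ennreal (normal_density 0 s x))"
  with integrable_normal_moment[of s 0 n] show ?thesis
    by (subst (asm) distributed_integrable[of M lborel Y "normal_density 0 s"]) auto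
qed

text \<open>The factor is the double factorial \<open>(2k-1)!!\<close>. Writing the moment through
  the second moment instead of \<open>\<sigma>\<close> covers the degenerate case by the same
  formula.\<close>

lemma gaussian_square_moment:
  assumes "centered_gaussian_rv M Y"
  shows "expectation (\<lambda>\<omega>. Y \<omega> ^ (2 * k)) = fact (2 * k) / (2 ^ k * fact k) * expectation (\<lambda>\<omega>. (Y \<omega>)\<^sup>2) ^ k"
  using assms unfolding centered_gaussian_rv_def
proof (elim conjE disjE exE)
  assume [measurable]: "Y \<in> borel_measurable M" and "AE \<omega> in M. Y \<omega> = 0"
  then have *: "expectation (\<lambda>\<omega>. Y \<omega> ^ n) = 0 ^ n" for n
    by (subst integral_cong_AE[where g = "\<lambda>_. 0 ^ n"]) (auto simp: prob_space)
  show ?thesis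
    unfolding * by (cases k) auto
next
  fix s :: real
  assume s: "0 < s" and d: "distributed M lborel Y (\<lambda>x. ennreal (normal_density 0 s x))"
  have "expectation (\<lambda>\<omega>. Y \<omega> ^ (2 * j)) = fact (2 * j) / ((2 / s\<^sup>2) ^ j * fact j)" for j
    using distributed_integral[OF d, of "\<lambda>x. x ^ (2 * j)"] integral_normal_moment_even[OF s, of 0 j]
    by simp
  note * = this
  have "expectation (\<lambda>\<omega>. (Y \<omega>)\<^sup>2) = s\<^sup>2"
    using *[of 1] s by simp
  then show ?thesis
    using *[of k] s by (simp add: field_simps)
qed

lemma gaussian_mean:
  assumes "centered_gaussian_rv M Y"
  shows "expectation Y = 0"
  using assms unfolding centered_gaussian_rv_def
proof (elim conjE disjE exE)
  assume [measurable]: "Y \<in> borel_measurable M" and "AE \<omega> in M. Y \<omega> = 0"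
  then show ?thesis
    by (subst integral_cong_AE[where g = "\<lambda>_. 0"]) auto
next
  fix s :: real
  assume s: "0 < s" and d: "distributed M lborel Y (\<lambda>x. ennreal (normal_density 0 s x))"
  show ?thesis
    using normal_distributed_expectation[OF s d] .
qed

text \<open>The argument 1 suffices: every multiple of a component of a Gaussian vector is again
  centered Gaussian, so a frequency can be absorbed into \<open>Y\<close>. The nondegenerate case
  rescales to the standard normal law.\<close>

lemma gaussian_char:
  assumes "centered_gaussian_rv M Y"
  shows "(CLINT \<omega>|M. iexp (Y \<omega>)) = exp (- expectation (\<lambda>\<omega>. (Y \<omega>)\<^sup>2) / 2)"
  using assms unfolding centered_gaussian_rv_def
proof (elim conjE disjE exE)
  assume [measurable]: "Y \<in> borel_measurable M" and 0: "AE \<omega> in M. Y \<omega> = 0"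
  have "(CLINT \<omega>|M. iexp (Y \<omega>)) = (CLINT \<omega>|M. 1)"
    using 0 by (intro integral_cong_AE) auto
  moreover have "expectation (\<lambda>\<omega>. (Y \<omega>)\<^sup>2) = expectation (\<lambda>\<omega>. 0)"
    using 0 by (intro integral_cong_AE) auto
  ultimately show ?thesis
    by (simp add: prob_space)
next
  fix s :: real
  assume [measurable]: "Y \<in> borel_measurable M" and s: "0 < s"
    and d: "distributed M lborel Y (\<lambda>x. ennreal (normal_density 0 s x))"
  have "distributed M lborel (\<lambda>\<omega>. Y \<omega> / s) std_normal_density"
    using d normal_standard_normal_convert[OF s, of Y 0] by simp
  then have *: "distr M borel (\<lambda>\<omega>. Y \<omega> / s) = std_normal_distribution"
    using distributed_distr_eq_density distr_cong[OF refl sets_lborel] by metis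
  have "(CLINT \<omega>|M. iexp (Y \<omega>)) = (CLINT \<omega>|M. iexp (s * (Y \<omega> / s)))"
    using s by simp
  also have "\<dots> = char (distr M borel (\<lambda>\<omega>. Y \<omega> / s)) s"
    unfolding char_def by (subst integral_distr) auto
  also have "\<dots> = exp (- s\<^sup>2 / 2)"
    by (simp add: * char_std_normal_distribution)
  also have "s\<^sup>2 = expectation (\<lambda>\<omega>. (Y \<omega>)\<^sup>2)"
    using distributed_integral[OF d, of "\<lambda>x. x ^ (2 * 1)"] integral_normal_moment_even[OF s, of 0 1] s
    by simp
  finally show ?thesis .
qed

end

text \<open>In characteristic 0 without zero divisors, polynomials that agree as functions are
  equal. This turns identities valid for all \<open>t\<close> into identities of moments.\<close>

lemma coeff_eqI_poly_fun:
  fixes p :: "'a::{comm_ring_1,ring_no_zero_divisors,ring_char_0} poly"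
  assumes "\<And>t. (\<Sum>k\<le>n. f k * t ^ k) = poly p t" "k \<le> n"
  shows "f k = coeff p k"
proof -
  have *: "(\<Sum>k\<le>n. monom (f k) k) = p"
    using assms(1) by (simp add: poly_eq_poly_eq_iff[symmetric] fun_eq_iff poly_sum poly_monom)
  show ?thesis
    unfolding *[symmetric] using assms(2) by (simp add: coeff_sum)
qed

text \<open>The exponent 4 arises from two, one or no factors \<open>C * t^2\<close>, the rest from
  \<open>B * t\<close>; the numbers are the multinomials 9!/(7!2!), 9!/(6!2!1!) and
  9!/(5!4!).\<close>

lemma coeff_quadratic_power_9:
  fixes A B C :: real
  shows "coeff ([:A, B, C:] ^ 9) 4 = 36 * A^7 * C^2 + 252 * A^6 * B^2 * C + 126 * A^5 * B^4"
  by (simp add: eval_nat_numeral algebra_simps)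

text \<open>The left side is the previous coefficient at \<open>A = 1 + 2as + s^2\<close>,
  \<open>B = 2(b + cs)\<close>, \<open>C = 1\<close>, divided by 12 and read off at
  \<open>s^6\<close>. Its value 3 * 35 = 105 at \<open>a = b = c = 0\<close> gives the factor on the
  right.\<close>

lemma coeff_moment_poly:
  fixes a b c :: real
  shows "3 * coeff ([:1, 2*a, 1:] ^ 7) 6 + 84 * coeff ([:1, 2*a, 1:] ^ 6 * [:b, c:]^2) 6
           + 168 * coeff ([:1, 2*a, 1:] ^ 5 * [:b, c:]^4) 6 = 105 * moment_poly a b c"
  by (simp add: moment_poly_def eval_nat_numeral algebra_simps)

text \<open>Dominated by the sum of squares, as
  \<open>\<bar>xy\<bar> \<le> x^2 + y^2\<close>.\<close>

lemma integrable_mult_of_squares: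
  fixes u v :: "'a \<Rightarrow> real"
  assumes [measurable]: "u \<in> borel_measurable M" "v \<in> borel_measurable M"
    and "integrable M (\<lambda>\<omega>. (u \<omega>)\<^sup>2)" "integrable M (\<lambda>\<omega>. (v \<omega>)\<^sup>2)"
  shows "integrable M (\<lambda>\<omega>. u \<omega> * v \<omega>)"
proof (rule Bochner_Integration.integrable_bound)
  show "integrable M (\<lambda>\<omega>. (u \<omega>)\<^sup>2 + (v \<omega>)\<^sup>2)"
    using assms by simp
  have "\<bar>x * y\<bar> \<le> x\<^sup>2 + y\<^sup>2" for x y :: real
    using sum_squares_bound[of "\<bar>x\<bar>" "\<bar>y\<bar>"] mult_nonneg_nonneg[of "\<bar>x\<bar>" "\<bar>y\<bar>"]
    unfolding abs_mult power2_abs by linarith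
  then show "AE \<omega> in M. norm (u \<omega> * v \<omega>) \<le> norm ((u \<omega>)\<^sup>2 + (v \<omega>)\<^sup>2)"
    by simp
qed simp

text \<open>The factor \<open>W\<close> carries along a power of a third variable while
  \<open>U\<close> and \<open>V\<close> are expanded.\<close>

lemma integral_binomial_expansion:
  fixes W U V :: "'a \<Rightarrow> real"
  assumes "\<And>k. k \<le> n \<Longrightarrow> integrable M (\<lambda>\<omega>. U \<omega> ^ (n - k) * V \<omega> ^ k * W \<omega>)"
  shows "(\<integral>\<omega>. (U \<omega> + t * V \<omega>) ^ n * W \<omega> \<partial>M)
           = (\<Sum>k\<le>n. (of_nat (n choose k) * (\<integral>\<omega>. U \<omega> ^ (n - k) * V \<omega> ^ k * W \<omega> \<partial>M)) * t ^ k)"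
proof -
  have "(\<integral>\<omega>. (U \<omega> + t * V \<omega>) ^ n * W \<omega> \<partial>M)
      = (\<integral>\<omega>. (\<Sum>k\<le>n. (of_nat (n choose k) * t ^ k) * (U \<omega> ^ (n - k) * V \<omega> ^ k * W \<omega>)) \<partial>M)"
    by (subst add.commute, subst binomial_ring)
       (simp add: sum_distrib_left sum_distrib_right power_mult_distrib mult_ac)
  also have "\<dots> = (\<Sum>k\<le>n. (of_nat (n choose k) * t ^ k) * (\<integral>\<omega>. U \<omega> ^ (n - k) * V \<omega> ^ k * W \<omega> \<partial>M))"
    using assms by simp
  finally show ?thesis
    by (simp add: mult_ac)
qed

section \<open>Mixed moments of jointly Gaussian variables\<close>

context prob_space
begin

lemma gaussian_measurable [measurable_dest]: "centered_gaussian_rv M Y \<Longrightarrow> Y \<in> borel_measurable M"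
  by (simp add: centered_gaussian_rv_def)

text \<open>Squaring each factor doubles its exponent, which reduces a mixed power to powers of one
  variable.\<close>

lemma gaussian_integrable_power2:
  assumes "centered_gaussian_rv M U" "centered_gaussian_rv M V"
  shows "integrable M (\<lambda>\<omega>. U \<omega> ^ i * V \<omega> ^ j)"
  using assms gaussian_integrable_power[of U "i * 2"] gaussian_integrable_power[of V "j * 2"]
  by (intro integrable_mult_of_squares) (auto simp flip: power_mult)

lemma gaussian_integrable_power3:
  assumes "centered_gaussian_rv M U" "centered_gaussian_rv M V" "centered_gaussian_rv M W"
  shows "integrable M (\<lambda>\<omega>. U \<omega> ^ i * V \<omega> ^ j * W \<omega> ^ k)"
  using assms gaussian_integrable_power2[of U V "i * 2" "j * 2"] gaussian_integrable_power[of W "k * 2"]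
  by (intro integrable_mult_of_squares) (auto simp: power_mult_distrib simp flip: power_mult)

text \<open>Polarisation: \<open>U + tV\<close> is Gaussian for every \<open>t\<close>, so its
  moment of order \<open>2m\<close> is \<open>(2m-1)!!\<close> times the \<open>m\<close>-th power
  of a quadratic polynomial in \<open>t\<close>. The binomial expansion of that moment has the mixed
  moments as coefficients.\<close>

lemma gaussian_pair_moment:
  assumes gauss: "centered_gaussian_rv M U" "centered_gaussian_rv M V"
      "\<And>t. centered_gaussian_rv M (\<lambda>\<omega>. U \<omega> + t * V \<omega>)"
    and "k \<le> 2 * m"
  shows "of_nat (2 * m choose k) * expectation (\<lambda>\<omega>. U \<omega> ^ (2 * m - k) * V \<omega> ^ k)
    = fact (2 * m) / (2 ^ m * fact m) * coeff ([:expectation (\<lambda>\<omega>. (U \<omega>)\<^sup>2),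
        2 * expectation (\<lambda>\<omega>. U \<omega> * V \<omega>), expectation (\<lambda>\<omega>. (V \<omega>)\<^sup>2):] ^ m) k"
proof -
  define q where "q = [:expectation (\<lambda>\<omega>. (U \<omega>)\<^sup>2), 2 * expectation (\<lambda>\<omega>. U \<omega> * V \<omega>), expectation (\<lambda>\<omega>. (V \<omega>)\<^sup>2):]"
  have expand: "expectation (\<lambda>\<omega>. (U \<omega> + t * V \<omega>) ^ n)
      = (\<Sum>k\<le>n. (of_nat (n choose k) * expectation (\<lambda>\<omega>. U \<omega> ^ (n - k) * V \<omega> ^ k)) * t ^ k)" for t n
    using integral_binomial_expansion[of n M U V "\<lambda>_. 1" t] gaussian_integrable_power2[OF gauss(1,2)]
    by simp
  have q: "expectation (\<lambda>\<omega>. (U \<omega> + t * V \<omega>)\<^sup>2) = poly q t" for t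
    unfolding expand by (simp add: q_def eval_nat_numeral algebra_simps)
  have "of_nat (2 * m choose k) * expectation (\<lambda>\<omega>. U \<omega> ^ (2 * m - k) * V \<omega> ^ k)
      = coeff (smult (fact (2 * m) / (2 ^ m * fact m)) (q ^ m)) k"
  proof (rule coeff_eqI_poly_fun[OF _ \<open>k \<le> 2 * m\<close>])
    fix t
    show "(\<Sum>k\<le>2 * m. of_nat (2 * m choose k) * expectation (\<lambda>\<omega>. U \<omega> ^ (2 * m - k) * V \<omega> ^ k) * t ^ k)
        = poly (smult (fact (2 * m) / (2 ^ m * fact m)) (q ^ m)) t"
      unfolding expand[symmetric] gaussian_square_moment[OF gauss(3)] q by simp
  qed
  then show ?thesis
    by (simp add: q_def)
qed

lemma gaussian_moment_8_6_4:
  assumes gauss: "\<And>x y z. centered_gaussian_rv M (\<lambda>\<omega>. x * X \<omega> + y * Y \<omega> + z * Z \<omega>)"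
    and var: "expectation (\<lambda>\<omega>. (X \<omega>)\<^sup>2) = 1" "expectation (\<lambda>\<omega>. (Y \<omega>)\<^sup>2) = 1" "expectation (\<lambda>\<omega>. (Z \<omega>)\<^sup>2) = 1"
  shows "expectation (\<lambda>\<omega>. X \<omega> ^ 8 * Y \<omega> ^ 6 * Z \<omega> ^ 4) = 4725 * moment_poly
    (expectation (\<lambda>\<omega>. X \<omega> * Y \<omega>)) (expectation (\<lambda>\<omega>. X \<omega> * Z \<omega>)) (expectation (\<lambda>\<omega>. Y \<omega> * Z \<omega>))"
proof -
  define a b c where abc: "a = expectation (\<lambda>\<omega>. X \<omega> * Y \<omega>)" "b = expectation (\<lambda>\<omega>. X \<omega> * Z \<omega>)" "c = expectation (\<lambda>\<omega>. Y \<omega> * Z \<omega>)"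
  \<comment> \<open>As polynomials in \<open>s\<close>, these are the variance of
    \<open>X + sY\<close> and its covariance with \<open>Z\<close>.\<close>
  define Q L where QL: "Q = [:1, 2 * a, 1:]" "L = [:b, c:]"
  have X: "centered_gaussian_rv M X" and Y: "centered_gaussian_rv M Y" and Z: "centered_gaussian_rv M Z"
    and XY: "centered_gaussian_rv M (\<lambda>\<omega>. X \<omega> + s * Y \<omega>)" for s
    using gauss[of 1 0 0] gauss[of 0 1 0] gauss[of 0 0 1] gauss[of 1 s 0] by simp_all
  have int2: "integrable M (\<lambda>\<omega>. (X \<omega>)\<^sup>2)" "integrable M (\<lambda>\<omega>. (Y \<omega>)\<^sup>2)" "integrable M (\<lambda>\<omega>. X \<omega> * Y \<omega>)"
    "integrable M (\<lambda>\<omega>. X \<omega> * Z \<omega>)" "integrable M (\<lambda>\<omega>. Y \<omega> * Z \<omega>)"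
    using gaussian_integrable_power[OF X] gaussian_integrable_power[OF Y]
      gaussian_integrable_power2[OF X Y, of 1 1] gaussian_integrable_power2[OF X Z, of 1 1]
      gaussian_integrable_power2[OF Y Z, of 1 1] by simp_all
  have pair: "expectation (\<lambda>\<omega>. (X \<omega> + s * Y \<omega>) ^ 14 * Z \<omega> ^ 4)
      = 135135 * poly (smult 3 (Q ^ 7) + smult 84 (Q ^ 6 * L ^ 2) + smult 168 (Q ^ 5 * L ^ 4)) s" for s
  proof -
    have sq: "(X \<omega> + s * Y \<omega>)\<^sup>2 = (X \<omega>)\<^sup>2 + 2 * s * (X \<omega> * Y \<omega>) + s\<^sup>2 * (Y \<omega>)\<^sup>2" for \<omega>
      by (simp add: power2_eq_square algebra_simps)
    have "expectation (\<lambda>\<omega>. (X \<omega> + s * Y \<omega>)\<^sup>2) = 1 + 2 * s * a + s\<^sup>2"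
      unfolding sq using int2 by (simp add: var abc)
    then have A: "expectation (\<lambda>\<omega>. (X \<omega> + s * Y \<omega>)\<^sup>2) = poly Q s"
      by (simp add: QL algebra_simps power2_eq_square)
    have B: "expectation (\<lambda>\<omega>. (X \<omega> + s * Y \<omega>) * Z \<omega>) = poly L s"
      using int2 by (simp add: distrib_right mult.assoc QL abc)
    \<comment> \<open>First extraction: the pair \<open>X + sY\<close>, \<open>Z\<close> with total
      degree 18 = 14 + 4.\<close>
    have "of_nat (18 choose 4) * expectation (\<lambda>\<omega>. (X \<omega> + s * Y \<omega>) ^ 14 * Z \<omega> ^ 4)
        = fact 18 / (2 ^ 9 * fact 9) * coeff ([:poly Q s, 2 * poly L s, 1:] ^ 9) 4"
      using gaussian_pair_moment[OF XY Z, of s 4 9] gauss[of 1 s] unfolding A B var by simp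
    \<comment> \<open>With \<open>A = Q(s)\<close>, \<open>B = 2L(s)\<close>, \<open>C = 1\<close>
      the coefficients are 36, 1008, 2016, that is 12 times 3, 84, 168; and 17!! * 12 / 3060 =
      135135, where 3060 is \<open>18 choose 4\<close>.\<close>
    then show ?thesis
      unfolding coeff_quadratic_power_9
      by (simp add: binomial_fact fact_numeral power_mult_distrib)
  qed
  \<comment> \<open>Second extraction, now in \<open>s\<close>. Dividing 135135 * 105 by
    \<open>14 choose 6\<close> = 3003 gives 4725.\<close>
  have "of_nat (14 choose 6) * expectation (\<lambda>\<omega>. X \<omega> ^ (14 - 6) * Y \<omega> ^ 6 * Z \<omega> ^ 4)
      = coeff (smult 135135 (smult 3 (Q ^ 7) + smult 84 (Q ^ 6 * L ^ 2) + smult 168 (Q ^ 5 * L ^ 4))) 6"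
  proof (rule coeff_eqI_poly_fun[where n = 14])
    fix s
    show "(\<Sum>k\<le>14. of_nat (14 choose k) * expectation (\<lambda>\<omega>. X \<omega> ^ (14 - k) * Y \<omega> ^ k * Z \<omega> ^ 4) * s ^ k)
        = poly (smult 135135 (smult 3 (Q ^ 7) + smult 84 (Q ^ 6 * L ^ 2) + smult 168 (Q ^ 5 * L ^ 4))) s"
      using pair[of s] gaussian_integrable_power3[OF X Y Z]
      by (subst integral_binomial_expansion[symmetric]) simp_all
  qed simp
  also have "\<dots> = 135135 * (105 * moment_poly a b c)"
    unfolding QL coeff_smult coeff_add coeff_moment_poly ..
  finally show ?thesis
    by (simp add: binomial_fact fact_numeral abc)
qed

end

section \<open>Independence from characteristic functions\<close>

context prob_space
begin

text \<open>One exchange step: exponentials in \<open>U\<close> are replaced by an indicator, while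
  \<open>W\<close> stands for the remaining factors of a product.\<close>

lemma indicator_uncorrelated_if_char_uncorrelated:
  fixes U W :: "'a \<Rightarrow> real"
  assumes [measurable]: "U \<in> borel_measurable M" "W \<in> borel_measurable M" "A \<in> sets borel"
    and bound: "\<And>\<omega>. \<bar>W \<omega>\<bar> \<le> K"
    and char: "\<And>t. (CLINT \<omega>|M. iexp (t * U \<omega>) * W \<omega>)
                = (CLINT \<omega>|M. iexp (t * U \<omega>)) * expectation W"
  shows "expectation (\<lambda>\<omega>. indicator A (U \<omega>) * W \<omega>)
           = expectation (\<lambda>\<omega>. indicator A (U \<omega>)) * expectation W"
proof -
  \<comment> \<open>Shifting \<open>W\<close> makes it a positive density; \<open>U\<close> has the same characteristic function, hence the
    same law, under the reweighted measure.\<close>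
  define V where "V \<omega> = W \<omega> + K + 1" for \<omega>
  have [measurable]: "V \<in> borel_measurable M"
    unfolding V_def by measurable
  have V1: "1 \<le> V \<omega>" for \<omega>
    using bound[of \<omega>] by (simp add: V_def)
  have intW: "integrable M W"
    by (rule integrable_const_bound[where B = K]) (use bound in auto)
  then have intV: "integrable M V" and EV: "expectation V = expectation W + K + 1"
    unfolding V_def by (auto simp: prob_space)
  \<comment> \<open>The extra 1 in the shift keeps the normalising constant away from 0.\<close>
  have "expectation (\<lambda>_. 1) \<le> expectation V"
    using V1 intV by (intro integral_mono) auto
  then have pos: "0 < expectation V"
    by (simp add: prob_space)
  define N where "N = density M (\<lambda>\<omega>. ennreal (V \<omega> / expectation V))"
  have nonneg: "0 \<le> V \<omega> / expectation V" for \<omega>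
    using V1[of \<omega>] pos by simp
  have "emeasure N (space N) = ennreal (\<integral>\<omega>. V \<omega> / expectation V \<partial>M)"
    unfolding N_def using intV nonneg
    by (subst nn_integral_eq_integral[symmetric])
       (auto simp: emeasure_density intro!: nn_integral_cong)
  then have "prob_space N"
    using pos by (intro prob_spaceI) simp
  then interpret N: prob_space N .
  have [measurable]: "U \<in> borel_measurable N"
    by (simp add: N_def)
  have dM: "real_distribution (distr M borel U)"
    by (simp add: real_distribution_def real_distribution_axioms_def prob_space_distr)
  have dN: "real_distribution (distr N borel U)"
    by (simp add: real_distribution_def real_distribution_axioms_def N.prob_space_distr)
  have "char (distr N borel U) t = char (distr M borel U) t" for t
  proof -
    have iint: "integrable M (\<lambda>\<omega>. iexp (t * U \<omega>))"
      by (rule integrable_const_bound[where B = 1]) auto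
    have iintW: "integrable M (\<lambda>\<omega>. iexp (t * U \<omega>) * W \<omega>)"
      by (rule integrable_const_bound[where B = K]) (use bound in \<open>auto simp: norm_mult\<close>)
    have "char (distr N borel U) t = (CLINT \<omega>|N. iexp (t * U \<omega>))"
      unfolding char_def by (subst integral_distr) auto
    also have "\<dots> = (CLINT \<omega>|M. (V \<omega> / expectation V) *\<^sub>R iexp (t * U \<omega>))"
      unfolding N_def using nonneg by (subst integral_density) auto
    also have "\<dots> = (CLINT \<omega>|M. (iexp (t * U \<omega>) * W \<omega> + (K + 1) * iexp (t * U \<omega>)) / expectation V)"
      by (intro Bochner_Integration.integral_cong)
         (auto simp: V_def scaleR_conv_of_real field_simps)
    also have "\<dots> = ((CLINT \<omega>|M. iexp (t * U \<omega>) * W \<omega>) + (K + 1) * (CLINT \<omega>|M. iexp (t * U \<omega>))) / expectation V"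
      using iint iintW by simp
    \<comment> \<open>By \<open>char\<close> the characteristic function of \<open>U\<close> factors
      out of both summands; what remains is \<open>expectation V\<close>, which cancels.\<close>
    also have "\<dots> = (CLINT \<omega>|M. iexp (t * U \<omega>)) * complex_of_real (expectation W + K + 1) / expectation V"
      unfolding char by (simp add: algebra_simps)
    also have "\<dots> = (CLINT \<omega>|M. iexp (t * U \<omega>))"
      using pos unfolding EV[symmetric] by simp
    also have "\<dots> = char (distr M borel U) t"
      unfolding char_def by (subst integral_distr) auto
    finally show ?thesis .
  qed
  then have eq: "distr N borel U = distr M borel U"
    by (intro Levy_uniqueness dM dN ext)
  have iA: "integrable M (\<lambda>\<omega>. indicator A (U \<omega>) :: real)"
    by (rule integrable_const_bound[where B = 1]) (auto split: split_indicator)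
  have iAW: "integrable M (\<lambda>\<omega>. indicator A (U \<omega>) * W \<omega>)"
    by (rule integrable_const_bound[where B = K])
       (use bound order_trans[OF abs_ge_zero bound] in \<open>auto split: split_indicator\<close>)
  \<comment> \<open>Both laws give \<open>A\<close> the same mass. Cleared of the denominator, this
    equation has the \<open>K + 1\<close> terms on both sides, and they cancel.\<close>
  have "expectation (\<lambda>\<omega>. indicator A (U \<omega>)) = measure (distr M borel U) A"
    using integral_distr[of U M borel "indicator A :: real \<Rightarrow> real"] by simp
  also have "\<dots> = (\<integral>\<omega>. indicator A (U \<omega>) \<partial>N)"
    using integral_distr[of U N borel "indicator A :: real \<Rightarrow> real"] by (simp add: eq)
  also have "\<dots> = expectation (\<lambda>\<omega>. V \<omega> / expectation V * indicator A (U \<omega>))"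
    unfolding N_def using nonneg by (subst integral_density) auto
  also have "\<dots> = expectation (\<lambda>\<omega>. (indicator A (U \<omega>) * W \<omega> + (K + 1) * indicator A (U \<omega>)) / expectation V)"
    by (intro Bochner_Integration.integral_cong) (auto simp: V_def field_simps)
  also have "\<dots> = (expectation (\<lambda>\<omega>. indicator A (U \<omega>) * W \<omega>) + (K + 1) * expectation (\<lambda>\<omega>. indicator A (U \<omega>))) / expectation V"
    using iA iAW by simp
  finally show ?thesis
    using pos unfolding EV by (simp add: field_simps)
qed

text \<open>Apply the real version to \<open>Re Z\<close> and \<open>Im Z\<close>. These are linear
  combinations of \<open>Z\<close> and \<open>cnj Z\<close>, hence the hypothesis on the
  conjugate.\<close>

lemma indicator_uncorrelated_if_char_uncorrelated_complex:
  fixes U :: "'a \<Rightarrow> real" and Z :: "'a \<Rightarrow> complex"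
  assumes [measurable]: "U \<in> borel_measurable M" "Z \<in> borel_measurable M" "A \<in> sets borel"
    and bound: "\<And>\<omega>. norm (Z \<omega>) \<le> K"
    and char: "\<And>t. (CLINT \<omega>|M. iexp (t * U \<omega>) * Z \<omega>)
                = (CLINT \<omega>|M. iexp (t * U \<omega>)) * (CLINT \<omega>|M. Z \<omega>)"
    and char_cnj: "\<And>t. (CLINT \<omega>|M. iexp (t * U \<omega>) * cnj (Z \<omega>))
                = (CLINT \<omega>|M. iexp (t * U \<omega>)) * (CLINT \<omega>|M. cnj (Z \<omega>))"
  shows "(CLINT \<omega>|M. complex_of_real (indicator A (U \<omega>)) * Z \<omega>)
           = expectation (\<lambda>\<omega>. indicat_real A (U \<omega>)) * (CLINT \<omega>|M. Z \<omega>)"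
proof -
  have [measurable]: "(\<lambda>\<omega>. cnj (Z \<omega>)) \<in> borel_measurable M"
    by (rule measurable_compose[OF \<open>Z \<in> borel_measurable M\<close>])
       (intro borel_measurable_continuous_onI continuous_intros)
  have iZ: "integrable M Z" "integrable M (\<lambda>\<omega>. cnj (Z \<omega>))"
    by (rule integrable_const_bound[where B = K]; use bound in auto)+
  have iUZ: "integrable M (\<lambda>\<omega>. iexp (t * U \<omega>) * Z \<omega>)" "integrable M (\<lambda>\<omega>. iexp (t * U \<omega>) * cnj (Z \<omega>))" for t
    by (rule integrable_const_bound[where B = K]; use bound in \<open>auto simp: norm_mult\<close>)+
  have Re: "expectation (\<lambda>\<omega>. indicator A (U \<omega>) * Re (Z \<omega>)) = expectation (\<lambda>\<omega>. indicator A (U \<omega>)) * expectation (\<lambda>\<omega>. Re (Z \<omega>))"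
  proof (rule indicator_uncorrelated_if_char_uncorrelated[where K = K])
    show "\<bar>Re (Z \<omega>)\<bar> \<le> K" for \<omega>
      using abs_Re_le_cmod bound order_trans by blast
    fix t
    have *: "complex_of_real (Re z) = (z + cnj z) / 2" for z
      by (simp add: complex_eq_iff)
    show "(CLINT \<omega>|M. iexp (t * U \<omega>) * Re (Z \<omega>)) = (CLINT \<omega>|M. iexp (t * U \<omega>)) * expectation (\<lambda>\<omega>. Re (Z \<omega>))"
      unfolding integral_complex_of_real[symmetric] *
      using iZ iUZ[of t] char[of t] char_cnj[of t] by (simp add: distrib_left)
  qed simp_all
  have Im: "expectation (\<lambda>\<omega>. indicator A (U \<omega>) * Im (Z \<omega>)) = expectation (\<lambda>\<omega>. indicator A (U \<omega>)) * expectation (\<lambda>\<omega>. Im (Z \<omega>))"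
  proof (rule indicator_uncorrelated_if_char_uncorrelated[where K = K])
    show "\<bar>Im (Z \<omega>)\<bar> \<le> K" for \<omega>
      using abs_Im_le_cmod bound order_trans by blast
    fix t
    define k where "k = 2 * \<i>"
    have *: "complex_of_real (Im z) = (z - cnj z) / k" for z
      by (simp add: complex_eq_iff k_def)
    show "(CLINT \<omega>|M. iexp (t * U \<omega>) * Im (Z \<omega>)) = (CLINT \<omega>|M. iexp (t * U \<omega>)) * expectation (\<lambda>\<omega>. Im (Z \<omega>))"
      unfolding integral_complex_of_real[symmetric] *
      using iZ iUZ[of t] char[of t] char_cnj[of t] by (simp add: right_diff_distrib)
  qed simp_all
  have iAZ: "integrable M (\<lambda>\<omega>. complex_of_real (indicator A (U \<omega>)) * Z \<omega>)"
    by (rule integrable_const_bound[where B = K])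
       (use bound order_trans[OF norm_ge_zero bound] in \<open>auto split: split_indicator\<close>)
  show ?thesis
    using Re Im iAZ iZ by (simp add: complex_eq_iff flip: integral_Re integral_Im)
qed

text \<open>Interpolates between the factorised characteristic function (\<open>J = {}\<close>) and
  the product formula for events (\<open>J = I\<close>). Each induction step moves one index from
  the exponential to the indicators; \<open>t\<close> stays general because the step changes
  it.\<close>

lemma expectation_indicators_iexp:
  fixes X :: "'i \<Rightarrow> 'a \<Rightarrow> real"
  assumes "finite I"
    and X [measurable]: "\<And>i. i \<in> I \<Longrightarrow> X i \<in> borel_measurable M"
    and char: "\<And>t. (CLINT \<omega>|M. iexp (\<Sum>i\<in>I. t i * X i \<omega>)) = (\<Prod>i\<in>I. CLINT \<omega>|M. iexp (t i * X i \<omega>))"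
    and A: "\<And>i. i \<in> I \<Longrightarrow> A i \<in> sets borel"
    and "J \<subseteq> I"
  shows "(CLINT \<omega>|M. complex_of_real (\<Prod>i\<in>J. indicator (A i) (X i \<omega>)) * iexp (\<Sum>i\<in>I - J. t i * X i \<omega>))
           = (\<Prod>i\<in>J. expectation (\<lambda>\<omega>. indicat_real (A i) (X i \<omega>))) * (\<Prod>i\<in>I - J. CLINT \<omega>|M. iexp (t i * X i \<omega>))"
  using finite_subset[OF \<open>J \<subseteq> I\<close> \<open>finite I\<close>] \<open>J \<subseteq> I\<close>
proof (induction J arbitrary: t rule: finite_induct)
  case empty
  then show ?case
    using char by simp
next
  case (insert j J)
  then have j: "j \<in> I" and J: "J \<subseteq> I" "I - J = insert j (I - insert j J)"
      and fin: "finite (I - insert j J)" "finite J"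
    using \<open>finite I\<close> by auto
  define \<phi> where "\<phi> i s = (CLINT \<omega>|M. iexp (s * X i \<omega>))" for i s
  define p where "p = (\<Prod>i\<in>J. expectation (\<lambda>\<omega>. indicat_real (A i) (X i \<omega>)))"
  define Z where "Z t \<omega> = complex_of_real (\<Prod>i\<in>J. indicator (A i) (X i \<omega>))
    * iexp (\<Sum>i\<in>I - insert j J. t i * X i \<omega>)" for t \<omega>
  have [measurable]: "X j \<in> borel_measurable M" "A j \<in> sets borel"
    using X A j by auto
  have [measurable]: "(\<lambda>\<omega>. \<Prod>i\<in>J. indicat_real (A i) (X i \<omega>)) \<in> borel_measurable M"
    using X A J by (intro borel_measurable_prod) (auto intro!: borel_measurable_indicator measurable_compose[OF X])
  have [measurable]: "(\<lambda>\<omega>. \<Sum>i\<in>I - insert j J. t i * X i \<omega>) \<in> borel_measurable M" for t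
    using X by (intro borel_measurable_sum) auto
  have Z [measurable]: "Z t \<in> borel_measurable M" for t
    unfolding Z_def by measurable
  have Z_bound: "norm (Z t \<omega>) \<le> 1" for t \<omega>
    by (auto simp: Z_def norm_mult simp flip: prod_norm intro!: prod_le_1 split: split_indicator)
  \<comment> \<open>The integrand is that of the induction hypothesis with frequency
    \<open>s\<close> at \<open>j\<close>. Taking \<open>s = 0\<close> afterwards gives the mean of
    \<open>Z t\<close>.\<close>
  have key: "(CLINT \<omega>|M. iexp (s * X j \<omega>) * Z t \<omega>) = p * (\<phi> j s * (\<Prod>i\<in>I - insert j J. \<phi> i (t i)))" for s t
  proof -
    have "(CLINT \<omega>|M. iexp (s * X j \<omega>) * Z t \<omega>) =
      (CLINT \<omega>|M. complex_of_real (\<Prod>i\<in>J. indicator (A i) (X i \<omega>)) * iexp (\<Sum>i\<in>I - J. (t(j := s)) i * X i \<omega>))"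
      unfolding J(2) using fin
      by (intro Bochner_Integration.integral_cong refl)
         (auto simp: Z_def exp_add distrib_left intro!: sum.cong arg_cong[where f = exp] arg_cong[where f = of_real])
    also have "\<dots> = p * (\<Prod>i\<in>I - J. \<phi> i ((t(j := s)) i))"
      unfolding insert.IH[OF J(1)] p_def \<phi>_def by simp
    also have "(\<Prod>i\<in>I - J. \<phi> i ((t(j := s)) i)) = \<phi> j s * (\<Prod>i\<in>I - insert j J. \<phi> i (t i))"
      unfolding J(2) using fin by (auto intro!: prod.cong)
    finally show ?thesis .
  qed
  have EZ: "(CLINT \<omega>|M. Z t \<omega>) = p * (\<Prod>i\<in>I - insert j J. \<phi> i (t i))" for t
    using key[of 0 t] by (simp add: \<phi>_def prob_space)
  have uncor: "(CLINT \<omega>|M. iexp (s * X j \<omega>) * Z t \<omega>)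
      = (CLINT \<omega>|M. iexp (s * X j \<omega>)) * (CLINT \<omega>|M. Z t \<omega>)" for s t
    unfolding key EZ \<phi>_def by (simp only: mult_ac)
  \<comment> \<open>Conjugation only negates the frequencies, so \<open>uncor\<close> also serves
    for the conjugate.\<close>
  have cnj_Z: "cnj (Z t \<omega>) = Z (\<lambda>i. - t i) \<omega>" for t \<omega>
    by (simp add: Z_def sum_negf exp_cnj)
  have "(CLINT \<omega>|M. complex_of_real (indicator (A j) (X j \<omega>)) * Z t \<omega>)
      = expectation (\<lambda>\<omega>. indicat_real (A j) (X j \<omega>)) * (CLINT \<omega>|M. Z t \<omega>)"
    by (rule indicator_uncorrelated_if_char_uncorrelated_complex[where K = 1])
       (simp_all only: Z_bound cnj_Z uncor, measurable)
  then show ?case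
    using insert.hyps fin unfolding EZ by (simp add: Z_def p_def \<phi>_def mult.assoc)
qed

lemma indep_vars_if_joint_char_factorises:
  fixes X :: "'i \<Rightarrow> 'a \<Rightarrow> real"
  assumes "finite I"
    and X [measurable]: "\<And>i. i \<in> I \<Longrightarrow> X i \<in> borel_measurable M"
    and char: "\<And>t. (CLINT \<omega>|M. iexp (\<Sum>i\<in>I. t i * X i \<omega>))
                = (\<Prod>i\<in>I. CLINT \<omega>|M. iexp (t i * X i \<omega>))"
  shows "indep_vars (\<lambda>_. borel) X I"
\<comment> \<open>The empty intersection would be \<open>UNIV\<close> instead of an event, so the
  empty index set is treated apart.\<close>
proof (cases "I = {}")
  case True
  then show ?thesis
    by (simp add: indep_vars_def2 indep_sets_def)
next
  case False
  have "prob (\<Inter>j\<in>I. B j) = (\<Prod>j\<in>I. prob (B j))"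
    if B: "B \<in> (\<Pi> i\<in>I. {X i -` A \<inter> space M |A. A \<in> sets borel})" for B
  proof -
    have "\<exists>A. \<forall>i\<in>I. B i = X i -` A i \<inter> space M \<and> A i \<in> sets borel"
      by (rule bchoice) (use B in blast)
    then obtain A where A: "\<And>i. i \<in> I \<Longrightarrow> B i = X i -` A i \<inter> space M" "\<And>i. i \<in> I \<Longrightarrow> A i \<in> sets borel"
      by blast
    have ev: "B i \<in> events" if "i \<in> I" for i
      using that A X by auto
    then have "(\<Inter>j\<in>I. B j) \<in> events"
      using False \<open>finite I\<close> by auto
    then have "prob (\<Inter>j\<in>I. B j) = expectation (\<lambda>\<omega>. indicator (\<Inter>j\<in>I. B j) \<omega>)"
      by simp
    also have "\<dots> = expectation (\<lambda>\<omega>. \<Prod>i\<in>I. indicator (A i) (X i \<omega>))"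
      using \<open>finite I\<close> False
      by (intro Bochner_Integration.integral_cong) (auto simp: A indicator_def)
    also have "complex_of_real \<dots> = of_real (\<Prod>i\<in>I. expectation (\<lambda>\<omega>. indicat_real (A i) (X i \<omega>)))"
      using expectation_indicators_iexp[OF \<open>finite I\<close> X char A(2) subset_refl]
      by (simp flip: of_real_prod)
    also have "(\<Prod>i\<in>I. expectation (\<lambda>\<omega>. indicat_real (A i) (X i \<omega>))) = (\<Prod>i\<in>I. expectation (indicator (B i)))"
      by (intro prod.cong Bochner_Integration.integral_cong) (auto simp: A indicator_def)
    also have "\<dots> = (\<Prod>i\<in>I. prob (B i))"
      using ev by (intro prod.cong) auto
    finally show ?thesis
      by (simp only: of_real_eq_iff)
  qed
  \<comment> \<open>Since each family contains the whole space, the product formula over all of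
    \<open>I\<close> yields the one over every subset.\<close>
  moreover have "space M \<in> {X i -` A \<inter> space M |A. A \<in> sets borel}" for i
    by (auto intro!: exI[of _ UNIV])
  ultimately show ?thesis
    using X unfolding indep_vars_def2
    by (subst indep_sets_finite[OF False \<open>finite I\<close>]) auto
qed

end

section \<open>The inequality\<close>

text \<open>Evaluates the quadratic form of the correlation matrix at vectors chosen to expose its
  minors.\<close>

lemma psd_det_nonneg:
  fixes a b c :: real
  assumes psd: "\<And>x y z. 0 \<le> x^2 + y^2 + z^2 + 2 * a * x * y + 2 * b * x * z + 2 * c * y * z"
  shows "0 \<le> 1 - a^2 - b^2 - c^2 + 2 * a * b * c"
proof -
  have "0 \<le> 1 - a^2"
    using psd[of "- a" 1 0] by (simp add: power2_eq_square)
  show ?thesis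
  proof (cases "a^2 = 1")
    case True
    \<comment> \<open>For \<open>a^2 = 1\<close> the vector \<open>(-a, 1, 0)\<close> is null;
      moving its last entry to \<open>-(c - ab)\<close> forces \<open>c = ab\<close>, which makes
      the determinant vanish.\<close>
    have "0 \<le> (1 - a^2) - (c - a * b)^2"
      using psd[of "- a" 1 "- (c - a * b)"] by (simp add: power2_eq_square algebra_simps)
    then have "c = a * b"
      using True by simp
    then have "1 - a^2 - b^2 - c^2 + 2 * a * b * c = (1 - a^2) * (1 - b^2)"
      by (simp add: power2_eq_square algebra_simps)
    then show ?thesis
      using True by simp
  next
    case False
    \<comment> \<open>The vector is the last column of the adjugate. The matrix maps it to the
      determinant times the third unit vector, so the form is the determinant times
      \<open>1 - a^2\<close>.\<close>
    have "0 \<le> (1 - a^2) * (1 - a^2 - b^2 - c^2 + 2 * a * b * c)"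
      using psd[of "a * c - b" "a * b - c" "1 - a^2"] by (simp add: power2_eq_square algebra_simps)
    then show ?thesis
      using False \<open>0 \<le> 1 - a^2\<close> by (simp add: zero_le_mult_iff)
  qed
qed

section \<open>Uncorrelated Gaussian vectors, and the moment bound\<close>

context prob_space
begin

lemma gaussian_vector_component:
  assumes "centered_gaussian_vector M X I" "finite I" "i \<in> I"
  shows "centered_gaussian_rv M (\<lambda>\<omega>. t * X i \<omega>)"
proof -
  have "(\<Sum>j\<in>I. (if j = i then t else 0) * X j \<omega>) = t * X i \<omega>" for \<omega>
    using assms(2,3) by (simp add: if_distrib[of "\<lambda>x. x * _"] cong: if_cong)
  moreover have "centered_gaussian_rv M (\<lambda>\<omega>. \<Sum>j\<in>I. (if j = i then t else 0) * X j \<omega>)"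
    using assms(1)[unfolded centered_gaussian_vector_def, rule_format, of "\<lambda>j. if j = i then t else 0"] .
  ultimately show ?thesis
    by simp
qed

text \<open>Vanishing covariances make the variance of a linear combination additive, and the
  Gaussian characteristic function turns this sum into a product.\<close>

lemma indep_vars_if_gaussian_uncorrelated:
  fixes X :: "'i \<Rightarrow> 'a \<Rightarrow> real"
  assumes gauss: "centered_gaussian_vector M X I" and "finite I"
    and uncor: "\<And>i j. i \<in> I \<Longrightarrow> j \<in> I \<Longrightarrow> i \<noteq> j \<Longrightarrow> expectation (\<lambda>\<omega>. X i \<omega> * X j \<omega>) = 0"
  shows "indep_vars (\<lambda>_. borel) X I"
proof (rule indep_vars_if_joint_char_factorises[OF \<open>finite I\<close>])
  have X: "centered_gaussian_rv M (\<lambda>\<omega>. t * X i \<omega>)" if "i \<in> I" for i t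
    using gaussian_vector_component[OF gauss \<open>finite I\<close> that] .
  then show "X i \<in> borel_measurable M" if "i \<in> I" for i
    using X[OF that, of 1] by (simp add: centered_gaussian_rv_def)
  fix t :: "'i \<Rightarrow> real"
  have int: "integrable M (\<lambda>\<omega>. X i \<omega> * X j \<omega>)" if "i \<in> I" "j \<in> I" for i j
    using gaussian_integrable_power2[OF X[OF that(1)] X[OF that(2)], of 1 1 1 1] by simp
  have "expectation (\<lambda>\<omega>. (\<Sum>i\<in>I. t i * X i \<omega>)\<^sup>2)
      = expectation (\<lambda>\<omega>. \<Sum>i\<in>I. \<Sum>j\<in>I. (t i * t j) * (X i \<omega> * X j \<omega>))"
    by (simp add: power2_eq_square sum_product mult_ac)
  also have "\<dots> = (\<Sum>i\<in>I. \<Sum>j\<in>I. (t i * t j) * expectation (\<lambda>\<omega>. X i \<omega> * X j \<omega>))"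
    using int by simp
  also have "\<dots> = (\<Sum>i\<in>I. \<Sum>j\<in>I. if j = i then (t i)\<^sup>2 * expectation (\<lambda>\<omega>. (X i \<omega>)\<^sup>2) else 0)"
    using uncor by (intro sum.cong) (auto simp: power2_eq_square)
  also have "\<dots> = (\<Sum>i\<in>I. expectation (\<lambda>\<omega>. (t i * X i \<omega>)\<^sup>2))"
    using \<open>finite I\<close> by (simp add: power_mult_distrib)
  finally have var: "expectation (\<lambda>\<omega>. (\<Sum>i\<in>I. t i * X i \<omega>)\<^sup>2) = (\<Sum>i\<in>I. expectation (\<lambda>\<omega>. (t i * X i \<omega>)\<^sup>2))" .
  have "(CLINT \<omega>|M. iexp (\<Sum>i\<in>I. t i * X i \<omega>)) = of_real (exp (- (\<Sum>i\<in>I. expectation (\<lambda>\<omega>. (t i * X i \<omega>)\<^sup>2)) / 2))"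
    unfolding var[symmetric] using gauss by (intro gaussian_char) (simp add: centered_gaussian_vector_def)
  also have "\<dots> = of_real (\<Prod>i\<in>I. exp (- expectation (\<lambda>\<omega>. (t i * X i \<omega>)\<^sup>2) / 2))"
    using \<open>finite I\<close> by (simp add: sum_negf sum_divide_distrib flip: exp_sum)
  also have "\<dots> = (\<Prod>i\<in>I. CLINT \<omega>|M. iexp (t i * X i \<omega>))"
    unfolding of_real_prod by (intro prod.cong refl gaussian_char[symmetric] X)
  finally show "(CLINT \<omega>|M. iexp (\<Sum>i\<in>I. t i * X i \<omega>)) = (\<Prod>i\<in>I. CLINT \<omega>|M. iexp (t i * X i \<omega>))" .
qed

text \<open>The determinant condition holds because every linear combination has nonnegative second
  moment. Here 1575 = 4725/3.\<close>

lemma standard_gaussian_moment_8_6_4_bound: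
  assumes gauss: "\<And>x y z. centered_gaussian_rv M (\<lambda>\<omega>. x * X \<omega> + y * Y \<omega> + z * Z \<omega>)"
    and var: "expectation (\<lambda>\<omega>. (X \<omega>)\<^sup>2) = 1" "expectation (\<lambda>\<omega>. (Y \<omega>)\<^sup>2) = 1" "expectation (\<lambda>\<omega>. (Z \<omega>)\<^sup>2) = 1"
  shows "4725 + 1575 * ((expectation (\<lambda>\<omega>. X \<omega> * Y \<omega>))\<^sup>2 + (expectation (\<lambda>\<omega>. X \<omega> * Z \<omega>))\<^sup>2
      + (expectation (\<lambda>\<omega>. Y \<omega> * Z \<omega>))\<^sup>2) \<le> expectation (\<lambda>\<omega>. X \<omega> ^ 8 * Y \<omega> ^ 6 * Z \<omega> ^ 4)"
proof -
  define a b c where abc: "a = expectation (\<lambda>\<omega>. X \<omega> * Y \<omega>)" "b = expectation (\<lambda>\<omega>. X \<omega> * Z \<omega>)" "c = expectation (\<lambda>\<omega>. Y \<omega> * Z \<omega>)"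
  have X: "centered_gaussian_rv M X" and Y: "centered_gaussian_rv M Y" and Z: "centered_gaussian_rv M Z"
    using gauss[of 1 0 0] gauss[of 0 1 0] gauss[of 0 0 1] by simp_all
  have int: "integrable M (\<lambda>\<omega>. (X \<omega>)\<^sup>2)" "integrable M (\<lambda>\<omega>. (Y \<omega>)\<^sup>2)" "integrable M (\<lambda>\<omega>. (Z \<omega>)\<^sup>2)"
    "integrable M (\<lambda>\<omega>. X \<omega> * Y \<omega>)" "integrable M (\<lambda>\<omega>. X \<omega> * Z \<omega>)" "integrable M (\<lambda>\<omega>. Y \<omega> * Z \<omega>)"
    using gaussian_integrable_power[OF X] gaussian_integrable_power[OF Y] gaussian_integrable_power[OF Z]
      gaussian_integrable_power2[OF X Y, of 1 1] gaussian_integrable_power2[OF X Z, of 1 1]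
      gaussian_integrable_power2[OF Y Z, of 1 1] by simp_all
  have "0 \<le> 1 - a^2 - b^2 - c^2 + 2 * a * b * c"
  proof (rule psd_det_nonneg)
    fix x y z :: real
    have sq: "(x * X \<omega> + y * Y \<omega> + z * Z \<omega>)\<^sup>2 = x^2 * (X \<omega>)\<^sup>2 + y^2 * (Y \<omega>)\<^sup>2 + z^2 * (Z \<omega>)\<^sup>2
        + 2 * x * y * (X \<omega> * Y \<omega>) + 2 * x * z * (X \<omega> * Z \<omega>) + 2 * y * z * (Y \<omega> * Z \<omega>)" for \<omega>
      by (simp add: power2_eq_square algebra_simps)
    have "0 \<le> expectation (\<lambda>\<omega>. (x * X \<omega> + y * Y \<omega> + z * Z \<omega>)\<^sup>2)"
      by simp
    also have "\<dots> = x^2 + y^2 + z^2 + 2 * x * y * a + 2 * x * z * b + 2 * y * z * c"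
      unfolding sq using int by (simp add: var abc)
    finally show "0 \<le> x^2 + y^2 + z^2 + 2 * a * x * y + 2 * b * x * z + 2 * c * y * z"
      by (simp add: mult_ac)
  qed
  from moment_poly_bound[OF this] show ?thesis
    unfolding gaussian_moment_8_6_4[OF gauss var] abc[symmetric] by linarith
qed

lemma gaussian_moment_8_6_4_bound:
  assumes gauss: "\<And>x y z. centered_gaussian_rv M (\<lambda>\<omega>. x * X \<omega> + y * Y \<omega> + z * Z \<omega>)"
    and pos: "0 < expectation (\<lambda>\<omega>. (X \<omega>)\<^sup>2)" "0 < expectation (\<lambda>\<omega>. (Y \<omega>)\<^sup>2)" "0 < expectation (\<lambda>\<omega>. (Z \<omega>)\<^sup>2)"
  shows "expectation (\<lambda>\<omega>. X \<omega> ^ 8) * expectation (\<lambda>\<omega>. Y \<omega> ^ 6) * expectation (\<lambda>\<omega>. Z \<omega> ^ 4)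
      \<le> expectation (\<lambda>\<omega>. X \<omega> ^ 8 * Y \<omega> ^ 6 * Z \<omega> ^ 4)" (is "?P \<le> ?E")
    and "expectation (\<lambda>\<omega>. X \<omega> ^ 8 * Y \<omega> ^ 6 * Z \<omega> ^ 4)
        = expectation (\<lambda>\<omega>. X \<omega> ^ 8) * expectation (\<lambda>\<omega>. Y \<omega> ^ 6) * expectation (\<lambda>\<omega>. Z \<omega> ^ 4)
      \<Longrightarrow> expectation (\<lambda>\<omega>. X \<omega> * Y \<omega>) = 0 \<and> expectation (\<lambda>\<omega>. X \<omega> * Z \<omega>) = 0 \<and> expectation (\<lambda>\<omega>. Y \<omega> * Z \<omega>) = 0"
proof -
  define p q r where pqr: "p = sqrt (expectation (\<lambda>\<omega>. (X \<omega>)\<^sup>2))" "q = sqrt (expectation (\<lambda>\<omega>. (Y \<omega>)\<^sup>2))"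
    "r = sqrt (expectation (\<lambda>\<omega>. (Z \<omega>)\<^sup>2))"
  then have pqr0: "0 < p" "0 < q" "0 < r"
      and var: "expectation (\<lambda>\<omega>. (X \<omega>)\<^sup>2) = p\<^sup>2" "expectation (\<lambda>\<omega>. (Y \<omega>)\<^sup>2) = q\<^sup>2" "expectation (\<lambda>\<omega>. (Z \<omega>)\<^sup>2) = r\<^sup>2"
    using pos by simp_all
  define A B C where ABC: "A = expectation (\<lambda>\<omega>. X \<omega> * Y \<omega>)" "B = expectation (\<lambda>\<omega>. X \<omega> * Z \<omega>)" "C = expectation (\<lambda>\<omega>. Y \<omega> * Z \<omega>)"
  define K where "K = p ^ 8 * q ^ 6 * r ^ 4"
  have "K > 0"
    using pqr0 by (simp add: K_def)
  have "centered_gaussian_rv M X" "centered_gaussian_rv M Y" "centered_gaussian_rv M Z"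
    using gauss[of 1 0 0] gauss[of 0 1 0] gauss[of 0 0 1] by simp_all
  from this[THEN gaussian_square_moment, of 4] this[THEN gaussian_square_moment, of 3] this[THEN gaussian_square_moment, of 2]
  have P: "?P = 4725 * K"
    by (simp add: var K_def fact_numeral flip: power_mult)
  \<comment> \<open>Dividing by the standard deviations gives unit variances; the three quotients
    are the correlations.\<close>
  have "4725 + 1575 * ((A / (p * q))\<^sup>2 + (B / (p * r))\<^sup>2 + (C / (q * r))\<^sup>2)
      \<le> expectation (\<lambda>\<omega>. (X \<omega> / p) ^ 8 * (Y \<omega> / q) ^ 6 * (Z \<omega> / r) ^ 4)"
    using standard_gaussian_moment_8_6_4_bound[of "\<lambda>\<omega>. X \<omega> / p" "\<lambda>\<omega>. Y \<omega> / q" "\<lambda>\<omega>. Z \<omega> / r"]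
      gauss[of "_ / p" "_ / q" "_ / r"] pqr0
    by (simp add: power_divide var ABC)
  also have "\<dots> = ?E / K"
    by (simp add: power_divide K_def)
  finally have E: "4725 * K + 1575 * K * ((A / (p * q))\<^sup>2 + (B / (p * r))\<^sup>2 + (C / (q * r))\<^sup>2) \<le> ?E"
    using \<open>K > 0\<close> by (simp add: field_simps)
  moreover have "0 \<le> 1575 * K * ((A / (p * q))\<^sup>2 + (B / (p * r))\<^sup>2 + (C / (q * r))\<^sup>2)"
    using \<open>K > 0\<close> by simp
  ultimately show "?P \<le> ?E"
    unfolding P by linarith
  \<comment> \<open>Equality leaves no room for the surplus, so all three correlations
    vanish.\<close>
  assume "?E = ?P"
  then have "(A / (p * q))\<^sup>2 + (B / (p * r))\<^sup>2 + (C / (q * r))\<^sup>2 \<le> 0"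
    using E \<open>K > 0\<close> unfolding P by (simp add: mult_le_0_iff)
  then have "(A / (p * q))\<^sup>2 = 0 \<and> (B / (p * r))\<^sup>2 = 0 \<and> (C / (q * r))\<^sup>2 = 0"
    by (smt (verit) zero_le_power2)
  then show "expectation (\<lambda>\<omega>. X \<omega> * Y \<omega>) = 0 \<and> expectation (\<lambda>\<omega>. X \<omega> * Z \<omega>) = 0 \<and> expectation (\<lambda>\<omega>. Y \<omega> * Z \<omega>) = 0"
    using pqr0 by (simp add: ABC)
qed

end

theorem theorem3p1:
  fixes M :: "'a measure" and X :: "nat \<Rightarrow> 'a \<Rightarrow> real"
  assumes "prob_space M"
    and "centered_gaussian_vector M X {1, 2, 3}"
    and "\<And>i. i \<in> {1, 2, 3} \<Longrightarrow> prob_space.variance M (X i) > 0"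
  shows "(prob_space.expectation M (\<lambda>\<omega>. X 1 \<omega> ^ 8 * X 2 \<omega> ^ 6 * X 3 \<omega> ^ 4)
           \<ge> prob_space.expectation M (\<lambda>\<omega>. X 1 \<omega> ^ 8)
             * prob_space.expectation M (\<lambda>\<omega>. X 2 \<omega> ^ 6)
             * prob_space.expectation M (\<lambda>\<omega>. X 3 \<omega> ^ 4)) \<and>
         (prob_space.expectation M (\<lambda>\<omega>. X 1 \<omega> ^ 8 * X 2 \<omega> ^ 6 * X 3 \<omega> ^ 4)
           = prob_space.expectation M (\<lambda>\<omega>. X 1 \<omega> ^ 8)
             * prob_space.expectation M (\<lambda>\<omega>. X 2 \<omega> ^ 6)
             * prob_space.expectation M (\<lambda>\<omega>. X 3 \<omega> ^ 4)
         \<longleftrightarrow> prob_space.indep_vars M (\<lambda>_. borel) X {1, 2, 3})"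
proof -
  interpret prob_space M by fact
  have comp: "centered_gaussian_rv M (X i)" if "i \<in> {1, 2, 3}" for i
    using gaussian_vector_component[OF assms(2) _ that, of 1] by simp
  have gauss: "centered_gaussian_rv M (\<lambda>\<omega>. x * X 1 \<omega> + y * X 2 \<omega> + z * X 3 \<omega>)" for x y z
  proof -
    have "centered_gaussian_rv M (\<lambda>\<omega>. \<Sum>i\<in>{1, 2, 3}. (if i = 1 then x else if i = 2 then y else z) * X i \<omega>)"
      using assms(2)[unfolded centered_gaussian_vector_def, rule_format,
          of "\<lambda>i. if i = 1 then x else if i = 2 then y else z"] .
    then show ?thesis
      by (simp add: add.assoc)
  qed
  \<comment> \<open>The mean is 0, so the variance is the second moment.\<close>
  have pos: "0 < expectation (\<lambda>\<omega>. (X i \<omega>)\<^sup>2)" if "i \<in> {1, 2, 3}" for i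
    using assms(3)[OF that] gaussian_mean[OF comp[OF that]] by simp
  have "0 < expectation (\<lambda>\<omega>. (X 1 \<omega>)\<^sup>2)" "0 < expectation (\<lambda>\<omega>. (X 2 \<omega>)\<^sup>2)"
    "0 < expectation (\<lambda>\<omega>. (X 3 \<omega>)\<^sup>2)"
    by (rule pos, simp)+
  note bound = gaussian_moment_8_6_4_bound[OF gauss this]
  show ?thesis
  proof (intro conjI iffI)
    assume eq: "expectation (\<lambda>\<omega>. X 1 \<omega> ^ 8 * X 2 \<omega> ^ 6 * X 3 \<omega> ^ 4)
      = expectation (\<lambda>\<omega>. X 1 \<omega> ^ 8) * expectation (\<lambda>\<omega>. X 2 \<omega> ^ 6) * expectation (\<lambda>\<omega>. X 3 \<omega> ^ 4)"
    show "indep_vars (\<lambda>_. borel) X {1, 2, 3}"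
      using bound(2)[OF eq]
      by (intro indep_vars_if_gaussian_uncorrelated[OF assms(2)]) (auto simp: mult.commute)
  next
    assume indep: "indep_vars (\<lambda>_. borel) X {1, 2, 3}"
    define k :: "nat \<Rightarrow> nat" where "k i = (if i = 1 then 8 else if i = 2 then 6 else 4)" for i
    \<comment> \<open>Powers of independent variables are independent, and they are integrable, so
      the expectation of the product factorises.\<close>
    have "expectation (\<lambda>\<omega>. \<Prod>i\<in>{1, 2, 3}. X i \<omega> ^ k i) = (\<Prod>i\<in>{1, 2, 3}. expectation (\<lambda>\<omega>. X i \<omega> ^ k i))"
      using indep_vars_compose2[OF indep, of "\<lambda>i x. x ^ k i" "\<lambda>_. borel"] gaussian_integrable_power[OF comp]
      by (intro indep_vars_lebesgue_integral) auto
    then show "expectation (\<lambda>\<omega>. X 1 \<omega> ^ 8 * X 2 \<omega> ^ 6 * X 3 \<omega> ^ 4)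
      = expectation (\<lambda>\<omega>. X 1 \<omega> ^ 8) * expectation (\<lambda>\<omega>. X 2 \<omega> ^ 6) * expectation (\<lambda>\<omega>. X 3 \<omega> ^ 4)"
      by (simp add: k_def mult.assoc)
  qed (rule bound(1))
qed

end
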